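(* Let $m$ be Lebesgue measure on $[0,1]$ and let $L_0$ be the space of (classes of) Lebesgue measurable functions $[0,1]\to\mathbb{R}$, where functions equal a.e. are identified. The family of all sequences $(f_n)_n\in L_0^{\mathbb{N}}$ such that $f_n\to 0$ in measure but $(f_n)_n$ does not converge (to zero) a.e. in $[0,1]$ is strongly $\mathfrak{c}$-algebrable.
   Context: $L_0^{\mathbb{N}}$ is the commutative real algebra of all sequences $(f_n)_{n\in\mathbb{N}}$ of elements of $L_0$, with coordinatewise operations, where elements of $L_0$ are added, multiplied and scaled pointwise a.e. $\mathfrak{c}$ denotes the cardinality of the continuum. A sequence $(f_n)_n\subset L_0$ converges to $f$ in measure if $\lim_{n\to\infty} m(\{x\in[0,1]: |f_n(x)-f(x)|>\varepsilon\})=0$ for every $\varepsilon>0$. It converges to $f$ a.e. in $[0,1]$ if there is a measurable set $E$ with $m(E)=0$ and $f_n\to f$ pointwise on $[0,1]\setminus E$. A subset $A$ of a commutative real algebra is strongly $\alpha$-algebrable ($\alpha$ a cardinal) if there is a free subalgebra $M$ (not required to be unital) generated by $\alpha$ free generators with $M\setminus\{0\}\subset A$. Equivalently, there is a set $B$ of cardinality $\alpha$, generating a subalgebra $M$ with $M\setminus\{0\}\subset A$, such that for every $s\in\mathbb{N}$, every nonzero real polynomial $P$ in $s$ variables without constant term, and every choice of distinct $f_1,\dots,f_s\in B$, one has $P(f_1,\dots,f_s)\ne 0$ (so that $P(f_1,\dots,f_s)\in M\setminus\{0\}\subset A$). *)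

theory Defs
  imports
    "HOL-Analysis.Analysis"
    "HOL-Library.Function_Algebras"
    "HOL-Library.Poly_Mapping"
begin

unbundle cardinal_syntax

section \<open>The algebra of classes of measurable functions on the unit interval\<close>

text \<open>
  Lebesgue measure on \<open>[0,1]\<close> is \<^term>\<open>lebesgue_on {0..1::real}\<close>. Representatives are functions
  on all of \<^typ>\<open>real\<close>; their values outside \<open>[0,1]\<close> are irrelevant, since the equivalence relation
  and all the notions below only look at points of \<open>[0,1]\<close>.
\<close>

definition ae_eq :: "(real \<Rightarrow> real) \<Rightarrow> (real \<Rightarrow> real) \<Rightarrow> bool" where
  "ae_eq f g \<longleftrightarrow>
     f \<in> borel_measurable (lebesgue_on {0..1}) \<and> g \<in> borel_measurable (lebesgue_on {0..1}) \<and>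
     (AE x in lebesgue_on {0..1}. f x = g x)"

quotient_type L0 = "real \<Rightarrow> real" / partial: ae_eq
proof (rule part_equivpI)
  show "\<exists>f. ae_eq f f"
    by (rule exI[of _ "\<lambda>_. 0"]) (simp add: ae_eq_def)
  show "symp ae_eq"
    by (rule sympI) (auto simp: ae_eq_def elim: AE_mp)
  show "transp ae_eq"
  proof (rule transpI)
    fix f g h assume fg: "ae_eq f g" and gh: "ae_eq g h"
    then have "AE x in lebesgue_on {0..1}. f x = g x" "AE x in lebesgue_on {0..1}. g x = h x"
      by (auto simp: ae_eq_def)
    then have "AE x in lebesgue_on {0..1}. f x = h x"
      by eventually_elim simp
    with fg gh show "ae_eq f h" by (simp add: ae_eq_def)
  qed
qed

instantiation L0 :: "{comm_ring_1, real_algebra_1}"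
begin

lift_definition zero_L0 :: L0 is "\<lambda>x. 0" by (simp add: ae_eq_def)
lift_definition one_L0 :: L0 is "\<lambda>x. 1" by (simp add: ae_eq_def)
lift_definition plus_L0 :: "L0 \<Rightarrow> L0 \<Rightarrow> L0" is "\<lambda>f g x. f x + g x"
  by (auto simp: ae_eq_def)
lift_definition minus_L0 :: "L0 \<Rightarrow> L0 \<Rightarrow> L0" is "\<lambda>f g x. f x - g x"
  by (auto simp: ae_eq_def)
lift_definition uminus_L0 :: "L0 \<Rightarrow> L0" is "\<lambda>f x. - f x"
  by (auto simp: ae_eq_def)
lift_definition times_L0 :: "L0 \<Rightarrow> L0 \<Rightarrow> L0" is "\<lambda>f g x. f x * g x"
  by (auto simp: ae_eq_def)
lift_definition scaleR_L0 :: "real \<Rightarrow> L0 \<Rightarrow> L0" is "\<lambda>c f x. c * f x"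
  by (auto simp: ae_eq_def)

instance
proof
  show "(0::L0) \<noteq> 1"
  proof (transfer, unfold ae_eq_def, safe)
    assume "AE x in lebesgue_on {0..1::real}. (0::real) = 1"
    then have "AE x in lebesgue_on {0..1::real}. x \<notin> {0..1}"
      by (rule AE_mp) simp
    then have "{0..1::real} \<in> null_sets (lebesgue_on {0..1})"
      by (subst AE_iff_null_sets) (simp_all add: sets_restrict_space_iff)
    then show False by (simp add: null_sets_def emeasure_restrict_space)
  qed
qed (transfer; auto simp: ae_eq_def algebra_simps)+

end

section \<open>Sequences as a real algebra\<close>

text \<open>
  The ring structure on functions is the pointwise one of \<^theory>\<open>HOL-Library.Function_Algebras\<close>.
\<close>

instantiation "fun" :: (type, real_vector) real_vector
begin

definition scaleR_fun :: "real \<Rightarrow> ('a \<Rightarrow> 'b) \<Rightarrow> 'a \<Rightarrow> 'b" where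
  "scaleR_fun c f = (\<lambda>x. c *\<^sub>R f x)"

instance
  by standard (simp_all add: scaleR_fun_def fun_eq_iff scaleR_add_right scaleR_add_left)

end

instance "fun" :: (type, real_algebra) real_algebra
  by standard (simp_all add: scaleR_fun_def fun_eq_iff algebra_simps)

instance "fun" :: (type, real_algebra_1) real_algebra_1 ..

section \<open>Convergence in measure and almost everywhere\<close>

text \<open>Lifting shows that both notions do not depend on the choice of representatives.\<close>

lift_definition tendsto_in_measure :: "(nat \<Rightarrow> L0) \<Rightarrow> L0 \<Rightarrow> bool" is
  "\<lambda>F f. \<forall>\<epsilon>>0.
     (\<lambda>n. measure (lebesgue_on {0..1}) {x \<in> {0..1}. \<bar>F n x - f x\<bar> > \<epsilon>}) \<longlonglongrightarrow> 0"
proof -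
  fix F G :: "nat \<Rightarrow> real \<Rightarrow> real" and f g :: "real \<Rightarrow> real"
  assume FG: "\<And>n. ae_eq (F n) (G n)" and fg: "ae_eq f g"
  have eq: "measure (lebesgue_on {0..1}) {x \<in> {0..1}. \<bar>F n x - f x\<bar> > \<epsilon>} =
        measure (lebesgue_on {0..1}) {x \<in> {0..1}. \<bar>G n x - g x\<bar> > \<epsilon>}" for n \<epsilon>
  proof (rule measure_eq_AE)
    have *: "ae_eq (F n) (G n)" by (rule FG)
    have [measurable]: "F n \<in> borel_measurable (lebesgue_on {0..1})"
      "G n \<in> borel_measurable (lebesgue_on {0..1})"
      "f \<in> borel_measurable (lebesgue_on {0..1})" "g \<in> borel_measurable (lebesgue_on {0..1})"
      using * fg by (auto simp: ae_eq_def)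
    have "AE x in lebesgue_on {0..1}. F n x = G n x" "AE x in lebesgue_on {0..1}. f x = g x"
      using * fg by (auto simp: ae_eq_def)
    then show "AE x in lebesgue_on {0..1}. (x \<in> {x \<in> {0..1}. \<bar>F n x - f x\<bar> > \<epsilon>}) =
        (x \<in> {x \<in> {0..1}. \<bar>G n x - g x\<bar> > \<epsilon>})"
      by eventually_elim simp
    have "{x \<in> space (lebesgue_on {0..1}). \<bar>F n x - f x\<bar> > \<epsilon>} \<in> sets (lebesgue_on {0..1})"
      by measurable
    then show "{x \<in> {0..1}. \<bar>F n x - f x\<bar> > \<epsilon>} \<in> sets (lebesgue_on {0..1})" by simp
    have "{x \<in> space (lebesgue_on {0..1}). \<bar>G n x - g x\<bar> > \<epsilon>} \<in> sets (lebesgue_on {0..1})"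
      by measurable
    then show "{x \<in> {0..1}. \<bar>G n x - g x\<bar> > \<epsilon>} \<in> sets (lebesgue_on {0..1})" by simp
  qed
  show "(\<forall>\<epsilon>>0. (\<lambda>n. measure (lebesgue_on {0..1}) {x \<in> {0..1}. \<bar>F n x - f x\<bar> > \<epsilon>}) \<longlonglongrightarrow> 0) =
        (\<forall>\<epsilon>>0. (\<lambda>n. measure (lebesgue_on {0..1}) {x \<in> {0..1}. \<bar>G n x - g x\<bar> > \<epsilon>}) \<longlonglongrightarrow> 0)"
    by (simp only: eq)
qed

lift_definition tendsto_ae :: "(nat \<Rightarrow> L0) \<Rightarrow> L0 \<Rightarrow> bool" is
  "\<lambda>F f. AE x in lebesgue_on {0..1}. (\<lambda>n. F n x) \<longlonglongrightarrow> f x"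
proof -
  fix F G :: "nat \<Rightarrow> real \<Rightarrow> real" and f g :: "real \<Rightarrow> real"
  assume FG: "\<And>n. ae_eq (F n) (G n)" and fg: "ae_eq f g"
  then have "AE x in lebesgue_on {0..1}. F n x = G n x" for n
    by (auto simp: ae_eq_def)
  then have "AE x in lebesgue_on {0..1}. \<forall>n. F n x = G n x"
    by (simp add: AE_all_countable)
  moreover have "AE x in lebesgue_on {0..1}. f x = g x"
    using fg by (simp add: ae_eq_def)
  ultimately have "AE x in lebesgue_on {0..1}.
      ((\<lambda>n. F n x) \<longlonglongrightarrow> f x) = ((\<lambda>n. G n x) \<longlonglongrightarrow> g x)"
    by eventually_elim simp
  then show "(AE x in lebesgue_on {0..1}. (\<lambda>n. F n x) \<longlonglongrightarrow> f x) =
      (AE x in lebesgue_on {0..1}. (\<lambda>n. G n x) \<longlonglongrightarrow> g x)"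
    by (rule eventually_subst)
qed

text \<open>
  For a sequence that tends to zero in measure, failing to converge to zero almost everywhere is the
  same as failing to converge almost everywhere.
\<close>

lemma tendsto_ae_zero_iff:
  assumes "tendsto_in_measure F 0"
  shows "tendsto_ae F 0 \<longleftrightarrow> (\<exists>g. tendsto_ae F g)"
proof -
  have "g = 0" if "tendsto_in_measure F 0" "tendsto_ae F g" for g
    using that
  proof (transfer, goal_cases)
    case (1 F g)
    let ?M = "lebesgue_on {0..1::real}"
    interpret finite_measure ?M
      by (rule finite_measureI) (simp add: emeasure_restrict_space)
    have [measurable]: "F n \<in> borel_measurable ?M" "g \<in> borel_measurable ?M" for n
      using 1(1,3) by (auto simp: ae_eq_def)
    have meas: "{x \<in> {0..1}. h x > \<epsilon>} \<in> sets ?M" if "h \<in> borel_measurable ?M" for h :: "real \<Rightarrow> real" and \<epsilon>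
    proof -
      have "{x \<in> space ?M. h x > \<epsilon>} \<in> sets ?M"
        using that by measurable
      then show ?thesis by simp
    qed
    have null: "{x \<in> {0..1}. \<bar>g x\<bar> > 2 * \<epsilon>} \<in> null_sets ?M" if "\<epsilon> > 0" for \<epsilon> :: real
    proof -
      let ?A = "\<lambda>n. {x \<in> {0..1}. \<bar>F n x - g x\<bar> > \<epsilon>}" and ?B = "\<lambda>n. {x \<in> {0..1}. \<bar>F n x - 0\<bar> > \<epsilon>}"
      have A: "?A n \<in> sets ?M" and B: "?B n \<in> sets ?M" for n
        by (rule meas; measurable)+
      have "(\<lambda>n. \<integral>x. indicat_real (?A n) x \<partial>?M) \<longlonglongrightarrow> (\<integral>x. 0 \<partial>?M)"
      proof (rule integral_dominated_convergence[where w = "\<lambda>_. 1"])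
        show "AE x in ?M. (\<lambda>n. indicat_real (?A n) x) \<longlonglongrightarrow> 0"
          using 1(4)
        proof eventually_elim
          case (elim x)
          then have "\<forall>\<^sub>F n in sequentially. dist (F n x) (g x) < \<epsilon>"
            using \<open>\<epsilon> > 0\<close> by (rule tendstoD)
          then have "\<forall>\<^sub>F n in sequentially. indicat_real (?A n) x = 0"
            by eventually_elim (auto simp: dist_real_def indicator_def)
          then show ?case by (rule tendsto_eventually)
        qed
      next
        show "indicat_real (?A n) \<in> borel_measurable ?M" for n
          by (rule borel_measurable_indicator[OF A])
      qed (auto simp: indicator_def)
      then have "(\<lambda>n. measure ?M (?A n)) \<longlonglongrightarrow> 0"
        by (simp add: Int_def conj_ac cong: conj_cong)
      moreover have "(\<lambda>n. measure ?M (?B n)) \<longlonglongrightarrow> 0"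
        using 1(2) \<open>\<epsilon> > 0\<close> by blast
      ultimately have lim: "(\<lambda>n. measure ?M (?A n) + measure ?M (?B n)) \<longlonglongrightarrow> 0"
        using tendsto_add by fastforce
      have "measure ?M {x \<in> {0..1}. \<bar>g x\<bar> > 2 * \<epsilon>} \<le> measure ?M (?A n) + measure ?M (?B n)" for n
      proof -
        have "measure ?M {x \<in> {0..1}. \<bar>g x\<bar> > 2 * \<epsilon>} \<le> measure ?M (?A n \<union> ?B n)"
          by (rule finite_measure_mono) (use A[of n] B[of n] in auto)
        also have "\<dots> \<le> measure ?M (?A n) + measure ?M (?B n)"
          by (rule measure_Un_le[OF A B])
        finally show ?thesis .
      qed
      then have "measure ?M {x \<in> {0..1}. \<bar>g x\<bar> > 2 * \<epsilon>} \<le> 0"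
        by (intro LIMSEQ_le_const[OF lim]) auto
      moreover have "{x \<in> {0..1}. \<bar>g x\<bar> > 2 * \<epsilon>} \<in> sets ?M"
        by (rule meas) measurable
      ultimately show ?thesis
        by (simp add: null_sets_def emeasure_eq_measure measure_le_0_iff)
    qed
    have "(\<Union>k. {x \<in> {0..1}. \<bar>g x\<bar> > 2 * (1 / real (Suc k))}) \<in> null_sets ?M"
      by (intro null_sets_UN null) simp
    then have "AE x in ?M. x \<notin> (\<Union>k. {x \<in> {0..1}. \<bar>g x\<bar> > 2 * (1 / real (Suc k))})"
      by (rule AE_not_in)
    then have "AE x in ?M. g x = 0"
      using AE_space
    proof eventually_elim
      case (elim x)
      show "g x = 0"
      proof (rule ccontr)
        assume "g x \<noteq> 0"
        then obtain k where "inverse (real (Suc k)) < \<bar>g x\<bar> / 2"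
          using reals_Archimedean[of "\<bar>g x\<bar> / 2"] by auto
        with elim show False by (auto simp: field_simps)
      qed
    qed
    then show ?case by (simp add: ae_eq_def)
  qed
  with assms show ?thesis by metis
qed

section \<open>Strong algebrability\<close>

text \<open>Subalgebras need not contain the unit of the ambient algebra.\<close>

definition subalgebra :: "'a::real_algebra set \<Rightarrow> bool" where
  "subalgebra S \<longleftrightarrow> subspace S \<and> (\<forall>x\<in>S. \<forall>y\<in>S. x * y \<in> S)"

text \<open>
  A real polynomial in the variables \<open>X\<^sub>0, X\<^sub>1, \<dots>\<close> is a finitely supported map from exponent vectors
  (themselves finitely supported) to coefficients. The exponent vector \<open>0\<close> is the one of the
  constant monomial, so \<^term>\<open>Poly_Mapping.lookup P 0\<close> is the constant term.
\<close>

type_synonym real_mpoly = "(nat \<Rightarrow>\<^sub>0 nat) \<Rightarrow>\<^sub>0 real"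

definition in_variables :: "nat \<Rightarrow> real_mpoly \<Rightarrow> bool" where
  "in_variables s P \<longleftrightarrow> (\<forall>a\<in>Poly_Mapping.keys P. Poly_Mapping.keys a \<subseteq> {..<s})"

definition mpoly_eval :: "(nat \<Rightarrow> 'a) \<Rightarrow> real_mpoly \<Rightarrow> 'a::{comm_ring_1, real_algebra_1}" where
  "mpoly_eval f P =
     (\<Sum>a\<in>Poly_Mapping.keys P. Poly_Mapping.lookup P a *\<^sub>R
        (\<Prod>i\<in>Poly_Mapping.keys a. f i ^ Poly_Mapping.lookup a i))"

definition free_generators :: "'a::{comm_ring_1, real_algebra_1} set \<Rightarrow> bool" where
  "free_generators B \<longleftrightarrow>
     (\<forall>s P f. in_variables s P \<and> P \<noteq> 0 \<and> Poly_Mapping.lookup P 0 = 0 \<and>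
        inj_on f {..<s} \<and> f ` {..<s} \<subseteq> B \<longrightarrow> mpoly_eval f P \<noteq> 0)"

definition strongly_algebrable ::
  "'k rel \<Rightarrow> 'a::{comm_ring_1, real_algebra_1} set \<Rightarrow> bool" where
  "strongly_algebrable \<alpha> A \<longleftrightarrow>
     (\<exists>B. |B| =o \<alpha> \<and> free_generators B \<and> (subalgebra hull B) - {0} \<subseteq> A)"

end

theory Submission
  imports Defs "HOL-Library.Discrete_Functions"
begin

text \<open>
  Let \<open>I\<^sub>n\<close> be intervals that sweep over \<open>[0,1]\<close> again and again while their lengths tend to zero. For
  every real sequence \<open>w\<close>, the sequence \<open>w n \<cdot> 1\<^bsub>I n\<^esub>\<close> tends to zero in measure, however fast \<open>w\<close>
  grows, because its supports shrink. If \<open>|w n|\<close> is eventually bounded away from zero, it converges to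
  zero at no point, because every point lies in infinitely many \<open>I\<^sub>n\<close>. As indicators are idempotent,
  \<open>weighted\<close>, which sends \<open>w\<close> to this sequence, is linear and multiplicative. What remains is a
  problem about real sequences: to find continuum many algebraically independent \<open>w\<close> for which every
  nonzero element of the algebra they generate is eventually bounded away from zero.

  The sequences \<open>exp (b\<^sup>n)\<close>, one for each real \<open>b > 1\<close>, have this property. A monomial in them is
  \<open>exp (e n)\<close> for a linear combination \<open>e\<close> of geometric sequences \<open>b\<^sup>n\<close> with natural coefficients.
  Of finitely many geometric sequences with ratios above one, the one with the largest ratio dominates
  the others. Hence a nontrivial linear combination of them diverges to plus or minus infinity
  (\<open>span_geometric_diverges\<close>). Applied to the difference of two exponents \<open>e\<close>, this says that of two
  distinct monomials one is negligible compared with the other (\<open>expo_scale\<close>). So a nontrivial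
  combination of monomials again has a dominant term, and since every monomial is eventually at least
  one, the combination stays away from zero (\<open>span_expo_bounded_below\<close>).

  The same argument on dominant terms is thus used at two levels, for the geometric sequences and for
  the exponentials of their combinations. It is carried out once, for an arbitrary family of positive
  sequences of pairwise different orders of growth (\<open>asymptotic_scale_leading_term\<close>), and also gives the
  linear independence of such a family. Independence at the lower level makes different exponent vectors
  give different monomials; independence at the upper level then makes the generators free.
\<close>

section \<open>Asymptotic scales\<close>

definition asymptotic_scale :: "(nat \<Rightarrow> real) set \<Rightarrow> bool" where
  "asymptotic_scale S \<longleftrightarrow> (\<forall>u\<in>S. \<forall>n. 0 < u n) \<and>
     (\<forall>u\<in>S. \<forall>v\<in>S. u \<noteq> v \<longrightarrow>
        (\<lambda>n. u n / v n) \<longlonglongrightarrow> 0 \<or> (\<lambda>n. v n / u n) \<longlonglongrightarrow> 0)"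

lemma sum_fun_apply: "(\<Sum>i\<in>A. f i) x = (\<Sum>i\<in>A. f i x)"
  for f :: "'i \<Rightarrow> 'b \<Rightarrow> 'c::comm_monoid_add"
  by (induction A rule: infinite_finite_induct) auto

text \<open>
  Negligibility is transitive on positive sequences and any two members of a scale are comparable, so
  a finite subset has a largest member.
\<close>

lemma asymptotic_scale_dominant_element:
  assumes "asymptotic_scale S" "finite T" "T \<noteq> {}" "T \<subseteq> S"
  shows "\<exists>v\<in>T. \<forall>u\<in>T - {v}. (\<lambda>n. u n / v n) \<longlonglongrightarrow> 0"
  using assms(2,3,4)
proof (induction T rule: finite_ne_induct)
  case (singleton w)
  then show ?case by auto
next
  case (insert w T)
  then obtain v where v: "v \<in> T" "\<And>u. u \<in> T - {v} \<Longrightarrow> (\<lambda>n. u n / v n) \<longlonglongrightarrow> 0"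
    by auto
  have pos: "v n > 0" "w n > 0" for n
    using assms(1) insert.prems v(1) by (auto simp: asymptotic_scale_def)
  have "v \<in> S" "w \<in> S" "w \<noteq> v"
    using insert v(1) by auto
  then consider "(\<lambda>n. w n / v n) \<longlonglongrightarrow> 0" | "(\<lambda>n. v n / w n) \<longlonglongrightarrow> 0"
    using assms(1) by (auto simp: asymptotic_scale_def)
  then show ?case
  proof cases
    case 1
    then show ?thesis
      using v by (intro bexI[of _ v]) auto
  next
    case 2
    have "(\<lambda>n. u n / w n) \<longlonglongrightarrow> 0" if "u \<in> T" for u
    proof (cases "u = v")
      case False
      then have "(\<lambda>n. (u n / v n) * (v n / w n)) \<longlonglongrightarrow> 0"
        using tendsto_mult[OF v(2) 2, of u] that by simp
      moreover have "(\<lambda>n. (u n / v n) * (v n / w n)) = (\<lambda>n. u n / w n)"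
        using pos by (intro ext) (simp add: less_imp_neq[symmetric])
      ultimately show ?thesis by (simp only:)
    qed (use 2 in simp)
    then show ?thesis
      by (intro bexI[of _ w]) auto
  qed
qed

text \<open>
  After division by the dominant member, all other terms of the combination tend to zero. The
  coefficient \<open>r v\<close> may vanish here; the lemma is applied to combinations whose coefficients are all
  nonzero.
\<close>

lemma asymptotic_scale_leading_term:
  assumes "asymptotic_scale S" "finite T" "T \<noteq> {}" "T \<subseteq> S"
  shows "\<exists>v\<in>T. (\<lambda>n. (\<Sum>u\<in>T. r u *\<^sub>R u) n / v n) \<longlonglongrightarrow> r v"
proof -
  obtain v where v: "v \<in> T" "\<And>u. u \<in> T - {v} \<Longrightarrow> (\<lambda>n. u n / v n) \<longlonglongrightarrow> 0"
    using asymptotic_scale_dominant_element[OF assms] by auto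
  have pos: "v n > 0" for n
    using assms(1,4) v(1) by (auto simp: asymptotic_scale_def)
  have "(\<lambda>n. r v + (\<Sum>u\<in>T - {v}. r u * (u n / v n))) \<longlonglongrightarrow> r v + (\<Sum>u\<in>T - {v}. r u * 0)"
    by (intro tendsto_intros v(2))
  moreover have leading: "(\<Sum>u\<in>T. r u *\<^sub>R u) n / v n = r v + (\<Sum>u\<in>T - {v}. r u * (u n / v n))" for n
    using pos[of n] \<open>finite T\<close> v(1)
    by (subst sum.remove[of _ v])
       (auto simp: sum_fun_apply scaleR_fun_def add_divide_distrib sum_divide_distrib)
  ultimately have "(\<lambda>n. (\<Sum>u\<in>T. r u *\<^sub>R u) n / v n) \<longlonglongrightarrow> r v"
    unfolding leading by simp
  then show ?thesis
    using v(1) by (rule bexI)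
qed

lemma asymptotic_scale_span:
  assumes "asymptotic_scale S" "w \<in> span S" "w \<noteq> 0"
  obtains v c where "v \<in> S" "c \<noteq> 0" "(\<lambda>n. w n / v n) \<longlonglongrightarrow> c"
proof -
  obtain r where r: "w = (\<Sum>u | r u \<noteq> 0. r u *\<^sub>R u)" "finite {u. r u \<noteq> 0}" "{u. r u \<noteq> 0} \<subseteq> S"
    using assms(2) unfolding span_explicit' by auto
  moreover have "{u. r u \<noteq> 0} \<noteq> {}"
    using r(1) assms(3) by (metis sum.empty)
  ultimately show thesis
    using asymptotic_scale_leading_term[OF assms(1), of "{u. r u \<noteq> 0}" r] that by auto
qed

text \<open>
  A vanishing combination would have a leading coefficient that is both nonzero and the limit of the
  zero sequence.
\<close>

lemma asymptotic_scale_independent: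
  assumes "asymptotic_scale S"
  shows "independent S"
  unfolding independent_alt
proof (intro allI impI)
  fix r :: "(nat \<Rightarrow> real) \<Rightarrow> real" and u
  assume r: "finite {u. r u \<noteq> 0}" "{u. r u \<noteq> 0} \<subseteq> S" "(\<Sum>u | r u \<noteq> 0. r u *\<^sub>R u) = 0"
  have "{u. r u \<noteq> 0} = {}"
  proof (rule ccontr)
    assume "{u. r u \<noteq> 0} \<noteq> {}"
    then obtain v where v: "r v \<noteq> 0" "(\<lambda>n. (\<Sum>u | r u \<noteq> 0. r u *\<^sub>R u) n / v n) \<longlonglongrightarrow> r v"
      using asymptotic_scale_leading_term[OF assms r(1) _ r(2), of r] by auto
    then have "(\<lambda>n. 0 :: real) \<longlonglongrightarrow> r v"
      by (simp add: r(3))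
    with v(1) show False
      by (simp add: LIMSEQ_const_iff)
  qed
  then show "r u = 0" by auto
qed

section \<open>Exponentials of exponential sums\<close>

definition geometric :: "(nat \<Rightarrow> real) set" where
  "geometric = (\<lambda>b n. b ^ n) ` {1<..}"

text \<open>
  Natural coefficients are relaxed to real ones, and their nonnegativity to eventual nonnegativity of the
  sequence. This keeps what the argument needs: closure under addition, differences inside the span,
  and exponentials that are eventually at least one.
\<close>

definition exponents :: "(nat \<Rightarrow> real) set" where
  "exponents = {e \<in> span geometric. \<forall>\<^sub>F n in sequentially. 0 \<le> e n}"

definition expo :: "(nat \<Rightarrow> real) \<Rightarrow> nat \<Rightarrow> real" where
  "expo e = (\<lambda>n. exp (e n))"

lemma inj_geometric: "inj (\<lambda>(b::real) n::nat. b ^ n)"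
  by (rule injI) (metis power_one_right)

lemma geometric_scale: "asymptotic_scale geometric"
proof -
  have *: "(\<lambda>n. a ^ n / b ^ n) \<longlonglongrightarrow> 0" if "1 < a" "a < b" for a b :: real
  proof -
    have "(\<lambda>n. (a / b) ^ n) \<longlonglongrightarrow> 0"
      using that by (intro LIMSEQ_power_zero) (simp add: field_simps)
    then show ?thesis by (simp add: power_divide)
  qed
  have "(\<lambda>n. a ^ n / b ^ n) \<longlonglongrightarrow> 0 \<or> (\<lambda>n. b ^ n / a ^ n) \<longlonglongrightarrow> 0"
    if "1 < a" "1 < b" "(\<lambda>n::nat. a ^ n) \<noteq> (\<lambda>n. b ^ n)" for a b :: real
    using that *[of a b] *[of b a] by (cases a b rule: linorder_cases) auto
  then show ?thesis
    unfolding asymptotic_scale_def geometric_def by auto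
qed

lemma zero_in_exponents: "0 \<in> exponents"
  by (simp add: exponents_def span_zero)

lemma exponents_add: "e \<in> exponents \<Longrightarrow> e' \<in> exponents \<Longrightarrow> e + e' \<in> exponents"
  by (auto simp: exponents_def span_add elim: eventually_elim2)

lemma exponents_scaleR: "0 \<le> c \<Longrightarrow> e \<in> exponents \<Longrightarrow> c *\<^sub>R e \<in> exponents"
  using span_scale[of e geometric c]
  by (auto simp: exponents_def scaleR_fun_def elim: eventually_mono)

lemma exponents_sum: "(\<And>i. i \<in> A \<Longrightarrow> e i \<in> exponents) \<Longrightarrow> sum e A \<in> exponents"
  by (induction A rule: infinite_finite_induct) (auto intro: zero_in_exponents exponents_add)

lemma power_in_exponents: "1 < b \<Longrightarrow> (\<lambda>n. b ^ n) \<in> exponents"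
  by (auto simp: exponents_def geometric_def intro!: span_base)

text \<open>
  The sequence is asymptotic to a nonzero multiple of some \<open>b\<^sup>n\<close> with \<open>b > 1\<close>.
\<close>

lemma span_geometric_diverges:
  assumes "e \<in> span geometric" "e \<noteq> 0"
  shows "filterlim e at_top sequentially \<or> filterlim e at_bot sequentially"
proof -
  obtain v c where v: "v \<in> geometric" and c: "c \<noteq> 0" and lim: "(\<lambda>n. e n / v n) \<longlonglongrightarrow> c"
    using asymptotic_scale_span[OF geometric_scale assms] .
  obtain b where b: "v = (\<lambda>n. b ^ n)" "b > 1"
    using v by (auto simp: geometric_def)
  have top: "filterlim v at_top sequentially"
    unfolding b(1) using b(2)
    by (intro filterlim_at_infinity_imp_filterlim_at_top filterlim_realpow_sequentially_gt1) auto
  have e: "e = (\<lambda>n. e n / v n * v n)"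
    using b by auto
  show ?thesis
  proof (cases "c > 0")
    case True
    then show ?thesis
      by (subst e, subst e) (blast intro: filterlim_tendsto_pos_mult_at_top[OF lim _ top])
  next
    case False
    then have "c < 0"
      using c by simp
    then show ?thesis
      by (subst e, subst e) (blast intro: filterlim_tendsto_neg_mult_at_bot[OF lim _ top])
  qed
qed

text \<open>
  The quotient of two exponentials is the exponential of the difference of the exponents. That
  difference lies in the span of the geometric sequences, so it tends to plus or minus infinity.
\<close>

lemma expo_scale: "asymptotic_scale (expo ` exponents)"
  unfolding asymptotic_scale_def
proof (intro conjI ballI allI impI)
  fix u v assume "u \<in> expo ` exponents" "v \<in> expo ` exponents" and ne: "u \<noteq> v"
  then obtain d e where de: "d \<in> exponents" "e \<in> exponents" "u = expo d" "v = expo e"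
    by auto
  have *: "(\<lambda>n. expo f n / expo g n) \<longlonglongrightarrow> 0" if "filterlim (f - g) at_bot sequentially"
    for f g :: "nat \<Rightarrow> real"
  proof -
    have "(\<lambda>n. exp ((f - g) n)) \<longlonglongrightarrow> 0"
      using filterlim_compose[OF exp_at_bot that] .
    then show ?thesis
      by (simp add: expo_def exp_diff)
  qed
  have "d - e \<in> span geometric" "d - e \<noteq> 0"
    using de ne by (auto simp: exponents_def span_diff)
  then consider "filterlim (d - e) at_top sequentially" | "filterlim (d - e) at_bot sequentially"
    using span_geometric_diverges by blast
  then show "(\<lambda>n. u n / v n) \<longlonglongrightarrow> 0 \<or> (\<lambda>n. v n / u n) \<longlonglongrightarrow> 0"
  proof cases
    case 1
    then have "filterlim (\<lambda>n. - (d - e) n) at_bot sequentially"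
      by (simp only: filterlim_uminus_at_bot minus_minus)
    moreover have "(\<lambda>n. - (d - e) n) = e - d"
      by auto
    ultimately show ?thesis
      using *[of e d] de by simp
  qed (use * de in blast)
qed (auto simp: expo_def)

lemma expo_0: "expo 0 = 1"
  by (auto simp: expo_def)

lemma expo_add: "expo (d + e) = expo d * expo e"
  by (auto simp: expo_def exp_add)

lemma expo_sum: "expo (sum e A) = (\<Prod>i\<in>A. expo (e i))"
  by (induction A rule: infinite_finite_induct) (simp_all only: sum.infinite sum.empty sum.insert
    prod.infinite prod.empty prod.insert expo_0 expo_add not_False_eq_True)

lemma expo_of_nat: "expo (real k *\<^sub>R e) = expo e ^ k"
proof (induction k)
  case (Suc k)
  have "real (Suc k) *\<^sub>R e = e + real k *\<^sub>R e"
    by (simp only: of_nat_Suc scaleR_add_left scaleR_one)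
  then show ?case
    by (simp only: expo_add Suc.IH power_Suc)
qed (simp only: of_nat_0 scaleR_zero_left expo_0 power_0)

lemma inj_expo: "inj expo"
  by (rule injI) (auto simp: expo_def fun_eq_iff)

text \<open>
  The exponentials are closed under multiplication because their exponents are closed under addition;
  their span is therefore an algebra.
\<close>

lemma span_expo_mult:
  assumes "v \<in> span (expo ` exponents)" "w \<in> span (expo ` exponents)"
  shows "v * w \<in> span (expo ` exponents)"
  using assms(1)
proof (induction rule: span_induct_alt)
  case base
  show ?case by (simp only: mult_zero_left mult_zero_right span_zero)
next
  case (step c d y)
  have "d * w \<in> span (expo ` exponents)"
    using assms(2)
  proof (induction rule: span_induct_alt)
    case base
    show ?case by (simp only: mult_zero_left mult_zero_right span_zero)
  next
    case (step k e z)
    have "d * e \<in> expo ` exponents"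
      using step(1) \<open>d \<in> _\<close> by (force simp flip: expo_add intro: exponents_add)
    then show ?case
      unfolding distrib_left mult_scaleR_right using step(2) by (intro span_add span_scale span_base[of "d * e"])
  qed
  then show ?case
    unfolding distrib_right mult_scaleR_left using step(2) by (intro span_add span_scale)
qed

text \<open>
  The leading term is a nonzero multiple of a sequence that is eventually at least one.
\<close>

lemma span_expo_bounded_below:
  assumes "w \<in> span (expo ` exponents)" "w \<noteq> 0"
  obtains \<delta> where "\<delta> > 0" "\<forall>\<^sub>F n in sequentially. \<delta> \<le> \<bar>w n\<bar>"
proof -
  obtain v c where v: "v \<in> expo ` exponents" and c: "c \<noteq> 0"
    and lim: "(\<lambda>n. w n / v n) \<longlonglongrightarrow> c"
    using asymptotic_scale_span[OF expo_scale assms] .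
  have "(\<lambda>n. \<bar>w n / v n\<bar>) \<longlonglongrightarrow> \<bar>c\<bar>"
    using lim by (rule tendsto_rabs)
  then have "\<forall>\<^sub>F n in sequentially. \<bar>c\<bar> / 2 < \<bar>w n / v n\<bar>"
    by (rule order_tendstoD) (use c in simp)
  moreover have "\<forall>\<^sub>F n in sequentially. 1 \<le> v n"
    using v by (auto simp: exponents_def expo_def elim: eventually_mono)
  ultimately have "\<forall>\<^sub>F n in sequentially. \<bar>c\<bar> / 2 \<le> \<bar>w n\<bar>"
  proof eventually_elim
    case (elim n)
    then have "\<bar>c\<bar> / 2 * 1 \<le> \<bar>w n / v n\<bar> * v n"
      by (intro mult_mono) auto
    also have "\<dots> = \<bar>w n\<bar>"
      using elim by (simp add: abs_divide)
    finally show ?case by simp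
  qed
  with c show thesis
    by (intro that[of "\<bar>c\<bar> / 2"]) auto
qed

section \<open>Algebraic independence\<close>

text \<open>
  The monomial with exponent vector \<open>a\<close>, evaluated at the sequences \<open>exp (b\<^sub>i\<^sup>n)\<close>, is the exponential of
  this sequence.
\<close>

definition exponent_of :: "(nat \<Rightarrow> real) \<Rightarrow> (nat \<Rightarrow>\<^sub>0 nat) \<Rightarrow> nat \<Rightarrow> real" where
  "exponent_of b a = (\<Sum>i\<in>Poly_Mapping.keys a. real (Poly_Mapping.lookup a i) *\<^sub>R (\<lambda>n. b i ^ n))"

lemma exponent_of_in_exponents:
  assumes "\<And>i. i \<in> Poly_Mapping.keys a \<Longrightarrow> 1 < b i"
  shows "exponent_of b a \<in> exponents"
  unfolding exponent_of_def
  by (intro exponents_sum exponents_scaleR power_in_exponents assms) auto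

text \<open>
  Two exponent vectors with the same value differ by a linear relation between distinct geometric
  sequences, which has to be trivial.
\<close>

lemma inj_on_exponent_of:
  assumes "inj_on b {..<s}" "\<And>i. i < s \<Longrightarrow> 1 < b i"
  shows "inj_on (exponent_of b) {a. Poly_Mapping.keys a \<subseteq> {..<s}}"
proof (rule inj_onI, clarify)
  fix a a' :: "nat \<Rightarrow>\<^sub>0 nat"
  assume keys: "Poly_Mapping.keys a \<subseteq> {..<s}" "Poly_Mapping.keys a' \<subseteq> {..<s}"
    and eq: "exponent_of b a = exponent_of b a'"
  define g where "g = (\<lambda>i n. b i ^ n)"
  define d where "d i = real (Poly_Mapping.lookup a i) - real (Poly_Mapping.lookup a' i)" for i
  have g: "inj_on g {..<s}" "g ` {..<s} \<subseteq> geometric"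
    using assms injD[OF inj_geometric]
    by (auto simp: g_def geometric_def inj_on_def)
  \<comment> \<open>A common index set, so that the two sums can be subtracted.\<close>
  have full: "exponent_of b a = (\<Sum>i<s. real (Poly_Mapping.lookup a i) *\<^sub>R g i)"
    if "Poly_Mapping.keys a \<subseteq> {..<s}" for a
    unfolding exponent_of_def g_def
    by (rule sum.mono_neutral_left) (use that in \<open>auto simp: in_keys_iff\<close>)
  have "0 = exponent_of b a - exponent_of b a'"
    using eq by simp
  also have "\<dots> = (\<Sum>i<s. d i *\<^sub>R g i)"
    by (simp add: full keys d_def scaleR_diff_left sum_subtractf)
  also have "\<dots> = (\<Sum>v\<in>g ` {..<s}. d (inv_into {..<s} g v) *\<^sub>R v)"
    by (subst sum.reindex[OF g(1)]) (simp add: inv_into_f_f[OF g(1)])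
  finally have "d (inv_into {..<s} g (g i)) = 0" if "i < s" for i
    by (intro independentD[OF asymptotic_scale_independent[OF geometric_scale] _ g(2),
          where u = "\<lambda>v. d (inv_into {..<s} g v)"]) (use that in simp_all)
  then have "Poly_Mapping.lookup a i = Poly_Mapping.lookup a' i" if "i < s" for i
    using that inv_into_f_f[OF g(1)] by (auto simp: d_def)
  moreover have "Poly_Mapping.lookup a i = 0" "Poly_Mapping.lookup a' i = 0" if "\<not> i < s" for i
    using keys that by (auto simp flip: not_in_keys_iff_lookup_eq_zero)
  ultimately show "a = a'"
    by (metis poly_mapping_eqI)
qed

lemma mpoly_eval_expo:
  "mpoly_eval (\<lambda>i. expo (\<lambda>n. b i ^ n)) P =
     (\<Sum>a\<in>Poly_Mapping.keys P. Poly_Mapping.lookup P a *\<^sub>R expo (exponent_of b a))"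
  by (simp add: mpoly_eval_def exponent_of_def expo_sum expo_of_nat)

lemma mpoly_eval_expo_in_span:
  assumes "in_variables s P" "\<And>i. i < s \<Longrightarrow> 1 < b i"
  shows "mpoly_eval (\<lambda>i. expo (\<lambda>n. b i ^ n)) P \<in> span (expo ` exponents)"
  unfolding mpoly_eval_expo
  by (intro span_sum span_scale span_base imageI exponent_of_in_exponents)
     (use assms in \<open>auto simp: in_variables_def\<close>)

text \<open>
  Distinct monomials evaluate to distinct exponentials, and those are linearly independent.
\<close>

lemma mpoly_eval_expo_nonzero:
  assumes P: "in_variables s P" "P \<noteq> 0" and b: "inj_on b {..<s}" "\<And>i. i < s \<Longrightarrow> 1 < b i"
  shows "mpoly_eval (\<lambda>i. expo (\<lambda>n. b i ^ n)) P \<noteq> 0"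
proof
  let ?m = "\<lambda>a. expo (exponent_of b a)" and ?K = "Poly_Mapping.keys P"
  assume "mpoly_eval (\<lambda>i. expo (\<lambda>n. b i ^ n)) P = 0"
  moreover have "?K \<subseteq> {a. Poly_Mapping.keys a \<subseteq> {..<s}}"
    using P(1) by (auto simp: in_variables_def)
  then have inj: "inj_on ?m ?K"
    using inj_on_subset[OF inj_on_exponent_of[OF b]] injD[OF inj_expo] by (auto simp: inj_on_def)
  ultimately have "(\<Sum>v\<in>?m ` ?K. Poly_Mapping.lookup P (inv_into ?K ?m v) *\<^sub>R v) = 0"
    by (subst sum.reindex[OF inj]) (simp add: mpoly_eval_expo inv_into_f_f[OF inj])
  moreover have sub: "?m ` ?K \<subseteq> expo ` exponents"
    using P(1) b(2) by (force simp: in_variables_def intro!: exponent_of_in_exponents)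
  ultimately have "Poly_Mapping.lookup P (inv_into ?K ?m (?m a)) = 0" if "a \<in> ?K" for a
    by (intro independentD[OF asymptotic_scale_independent[OF expo_scale] _ sub,
          where u = "\<lambda>v. Poly_Mapping.lookup P (inv_into ?K ?m v)"]) (use that in simp_all)
  then have "Poly_Mapping.lookup P a = 0" if "a \<in> ?K" for a
    using that inv_into_f_f[OF inj] by simp
  with P(2) show False
    by (metis in_keys_iff lookup_zero poly_mapping_eqI)
qed

section \<open>A sequence of sliding intervals\<close>

text \<open>
  For \<open>k > 0\<close>, the indices from \<open>k\<^sup>2\<close> to \<open>k\<^sup>2 + k\<close> run through the intervals of length \<open>1/k\<close> that cover \<open>[0,1]\<close>. For the
  remaining indices below \<open>(k + 1)\<^sup>2\<close> the interval lies to the right of \<open>[0,1]\<close>, so that the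
  intersection is empty.
\<close>

definition sliding_interval :: "nat \<Rightarrow> real set" where
  "sliding_interval n =
     (let k = floor_sqrt n; j = n - k\<^sup>2 in {real j / real k..(real j + 1) / real k} \<inter> {0..1})"

lemma sliding_interval_measurable [measurable]:
  "sliding_interval n \<in> sets (lebesgue_on {0..1})"
  by (auto simp: sliding_interval_def Let_def sets_restrict_space_iff)

lemma measure_sliding_interval_le:
  assumes "n > 0"
  shows "measure (lebesgue_on {0..1}) (sliding_interval n) \<le> 1 / real (floor_sqrt n)"
proof -
  let ?k = "floor_sqrt n" and ?j = "n - (floor_sqrt n)\<^sup>2"
  have k: "real ?k > 0" using assms by simp
  have "measure (lebesgue_on {0..1}) (sliding_interval n) = measure lebesgue (sliding_interval n)"
    by (rule measure_restrict_space) (auto simp: sliding_interval_def Let_def)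
  also have "\<dots> \<le> measure lebesgue {real ?j / real ?k..(real ?j + 1) / real ?k}"
    by (rule measure_mono_fmeasurable) (auto simp: sliding_interval_def Let_def)
  also have "\<dots> = 1 / real ?k"
    using k by (simp add: divide_right_mono diff_divide_distrib[symmetric])
  finally show ?thesis .
qed

lemma measure_sliding_interval_tendsto_0:
  "(\<lambda>n. measure (lebesgue_on {0..1}) (sliding_interval n)) \<longlonglongrightarrow> 0"
proof (rule tendsto_sandwich[OF _ _ tendsto_const])
  have "filterlim floor_sqrt at_top sequentially"
    unfolding filterlim_at_top
  proof
    fix k
    show "\<forall>\<^sub>F n in sequentially. k \<le> floor_sqrt n"
      using eventually_ge_at_top[of "k\<^sup>2"] by eventually_elim (simp add: le_floor_sqrtI)
  qed
  then show "(\<lambda>n. 1 / real (floor_sqrt n)) \<longlonglongrightarrow> 0"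
    using filterlim_compose[OF lim_1_over_n] by blast
  show "\<forall>\<^sub>F n in sequentially.
      measure (lebesgue_on {0..1}) (sliding_interval n) \<le> 1 / real (floor_sqrt n)"
    using eventually_gt_at_top[of 0] by eventually_elim (rule measure_sliding_interval_le)
qed auto

text \<open>
  In the sweep that starts at \<open>k\<^sup>2\<close>, the point \<open>x\<close> is met at the index \<open>k\<^sup>2 + \<lfloor>k x\<rfloor>\<close>.
\<close>

lemma frequently_in_sliding_interval:
  assumes "x \<in> {0..1}"
  shows "\<exists>\<^sub>F n in sequentially. x \<in> sliding_interval n"
  unfolding frequently_sequentially
proof
  fix N
  define k where "k = Suc N"
  define j where "j = nat \<lfloor>real k * x\<rfloor>"
  have x: "real j \<le> real k * x" "real k * x < real j + 1"
    using assms by (auto simp: j_def)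
  have "real k * x \<le> real k"
    using assms by (simp add: mult_left_le)
  then have "j \<le> k"
    using x(1) by linarith
  then have "floor_sqrt (k\<^sup>2 + j) = k"
    by (intro floor_sqrt_unique) (auto simp: power2_eq_square)
  then have "x \<in> sliding_interval (k\<^sup>2 + j)"
    using x assms by (auto simp: sliding_interval_def k_def field_simps)
  moreover have "N \<le> k\<^sup>2 + j"
    by (simp add: k_def power2_eq_square)
  ultimately show "\<exists>n\<ge>N. x \<in> sliding_interval n"
    by blast
qed

section \<open>Weighted sliding indicators\<close>

lift_definition sliding_indicator :: "nat \<Rightarrow> L0" is "\<lambda>n. indicator (sliding_interval n)"
  by (auto simp: ae_eq_def)

definition weighted :: "(nat \<Rightarrow> real) \<Rightarrow> nat \<Rightarrow> L0" where
  "weighted w = (\<lambda>n. w n *\<^sub>R sliding_indicator n)"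

lemma sliding_indicator_idem: "sliding_indicator n * sliding_indicator n = sliding_indicator n"
  by transfer (auto simp: ae_eq_def indicator_def)

lemma weighted_0: "weighted 0 = 0"
  by (auto simp: weighted_def)

lemma weighted_add: "weighted (v + w) = weighted v + weighted w"
  by (auto simp: weighted_def scaleR_add_left)

lemma weighted_scaleR: "weighted (c *\<^sub>R w) = c *\<^sub>R weighted w"
  by (auto simp: weighted_def scaleR_fun_def)

lemma weighted_mult: "weighted (v * w) = weighted v * weighted w"
  by (auto simp: weighted_def sliding_indicator_idem)

lemma weighted_sum: "weighted (sum w A) = (\<Sum>i\<in>A. weighted (w i))"
  by (induction A rule: infinite_finite_induct) (simp_all only: sum.infinite sum.empty sum.insert
    weighted_0 weighted_add not_False_eq_True)

lemma weighted_power: "0 < k \<Longrightarrow> weighted (w ^ k) = weighted w ^ k"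
  by (induction k rule: nat_induct_non_zero) (simp_all only: power_one_right power_Suc weighted_mult)

lemma weighted_prod: "finite A \<Longrightarrow> A \<noteq> {} \<Longrightarrow> weighted (prod w A) = (\<Prod>i\<in>A. weighted (w i))"
  by (induction A rule: finite_ne_induct)
     (simp_all only: prod.insert prod.empty finite.intros empty_iff mult_1_right weighted_mult not_False_eq_True)

text \<open>
  Multiplicative maps commute with the evaluation of polynomials, but \<open>weighted\<close> sends the constant
  sequence one to the sequence of indicators and not to the unit. A constant term must therefore be
  absent, and in the other monomials the product is over a nonempty set with positive exponents.
\<close>

lemma mpoly_eval_weighted:
  assumes "Poly_Mapping.lookup P 0 = 0"
  shows "mpoly_eval (\<lambda>i. weighted (w i)) P = weighted (mpoly_eval w P)"
  unfolding mpoly_eval_def weighted_sum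
proof (rule sum.cong[OF refl])
  fix a assume "a \<in> Poly_Mapping.keys P"
  then have "a \<noteq> 0"
    using assms by (auto simp: in_keys_iff)
  then show "Poly_Mapping.lookup P a *\<^sub>R
        (\<Prod>i\<in>Poly_Mapping.keys a. weighted (w i) ^ Poly_Mapping.lookup a i) =
      weighted (Poly_Mapping.lookup P a *\<^sub>R (\<Prod>i\<in>Poly_Mapping.keys a. w i ^ Poly_Mapping.lookup a i))"
    by (simp add: weighted_scaleR weighted_prod weighted_power in_keys_iff)
qed

text \<open>
  Whatever the values of \<open>w\<close> are, the exceptional sets are contained in the sliding intervals.
\<close>

lemma weighted_tendsto_in_measure: "tendsto_in_measure (weighted w) 0"
  unfolding weighted_def
proof (transfer, intro allI impI)
  fix w :: "nat \<Rightarrow> real" and \<epsilon> :: real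
  assume "\<epsilon> > 0"
  show "(\<lambda>n. measure (lebesgue_on {0..1})
      {x \<in> {0..1}. \<bar>w n * indicator (sliding_interval n) x - 0\<bar> > \<epsilon>}) \<longlonglongrightarrow> 0"
  proof (rule tendsto_sandwich[OF _ _ tendsto_const measure_sliding_interval_tendsto_0])
    interpret finite_measure "lebesgue_on {0..1::real}"
      by (rule finite_measureI) (simp add: emeasure_restrict_space)
    have "measure (lebesgue_on {0..1}) {x \<in> {0..1}. \<bar>w n * indicator (sliding_interval n) x - 0\<bar> > \<epsilon>}
        \<le> measure (lebesgue_on {0..1}) (sliding_interval n)" for n
      by (rule finite_measure_mono) (use \<open>\<epsilon> > 0\<close> in \<open>auto simp: indicator_def split: if_splits\<close>)
    then show "\<forall>\<^sub>F n in sequentially. measure (lebesgue_on {0..1})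
        {x \<in> {0..1}. \<bar>w n * indicator (sliding_interval n) x - 0\<bar> > \<epsilon>}
        \<le> measure (lebesgue_on {0..1}) (sliding_interval n)"
      by simp
  qed auto
qed

text \<open>
  At each point of \<open>[0,1]\<close> the modulus is at least \<open>\<delta>\<close> infinitely often.
\<close>

lemma weighted_not_tendsto_ae:
  assumes "\<delta> > 0" "\<forall>\<^sub>F n in sequentially. \<delta> \<le> \<bar>w n\<bar>"
  shows "\<not> tendsto_ae (weighted w) 0"
  unfolding weighted_def using assms
proof (transfer, intro notI)
  fix \<delta> :: real and w :: "nat \<Rightarrow> real"
  assume \<delta>: "\<delta> > 0" "\<forall>\<^sub>F n in sequentially. \<delta> \<le> \<bar>w n\<bar>"
    and ae: "AE x in lebesgue_on {0..1}. (\<lambda>n. w n * indicator (sliding_interval n) x) \<longlonglongrightarrow> 0"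
  have "\<not> (\<lambda>n. w n * indicator (sliding_interval n) x) \<longlonglongrightarrow> 0" if "x \<in> {0..1}" for x
  proof
    assume "(\<lambda>n. w n * indicator (sliding_interval n) x) \<longlonglongrightarrow> 0"
    then have "\<forall>\<^sub>F n in sequentially. \<bar>w n * indicator (sliding_interval n) x\<bar> < \<delta>"
      using tendstoD[OF _ \<delta>(1)] by fastforce
    with \<delta>(2) have "\<forall>\<^sub>F n in sequentially. x \<notin> sliding_interval n"
      by eventually_elim auto
    with frequently_in_sliding_interval[OF that] show False
      by (simp add: frequently_def)
  qed
  with ae have "AE x in lebesgue_on {0..1::real}. x \<notin> {0..1}"
    by (auto elim: eventually_mono)
  then have "{0..1::real} \<in> null_sets (lebesgue_on {0..1})"
    by (subst AE_iff_null_sets) (simp_all add: sets_restrict_space_iff)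
  then show False
    by (simp add: null_sets_def emeasure_restrict_space)
qed

lemma weighted_span_expo:
  assumes "w \<in> span (expo ` exponents)" "w \<noteq> 0"
  shows "tendsto_in_measure (weighted w) 0 \<and> \<not> tendsto_ae (weighted w) 0"
  using span_expo_bounded_below[OF assms] weighted_tendsto_in_measure weighted_not_tendsto_ae
  by metis

lemma tendsto_ae_0: "tendsto_ae 0 0"
proof -
  have "tendsto_ae (\<lambda>n. 0) 0" by transfer simp
  then show ?thesis by (simp add: zero_fun_def)
qed

text \<open>
  The zero sequence converges almost everywhere, so it cannot be the image of a nonzero \<open>w\<close>.
\<close>

lemma weighted_eq_0_iff:
  assumes "w \<in> span (expo ` exponents)"
  shows "weighted w = 0 \<longleftrightarrow> w = 0"
  using weighted_span_expo[OF assms] tendsto_ae_0 weighted_0 by metis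

lemma subalgebra_weighted: "subalgebra (weighted ` span (expo ` exponents))"
  unfolding subalgebra_def subspace_def
proof (intro conjI ballI allI)
  let ?W = "span (expo ` exponents)"
  show "0 \<in> weighted ` ?W"
    using span_zero weighted_0 by (metis imageI)
  show "x + y \<in> weighted ` ?W" if "x \<in> weighted ` ?W" "y \<in> weighted ` ?W" for x y
    using that by (auto simp flip: weighted_add intro!: imageI span_add)
  show "c *\<^sub>R x \<in> weighted ` ?W" if "x \<in> weighted ` ?W" for c x
    using that by (auto simp flip: weighted_scaleR intro!: imageI span_scale)
  show "x * y \<in> weighted ` ?W" if "x \<in> weighted ` ?W" "y \<in> weighted ` ?W" for x y
    using that by (auto simp flip: weighted_mult intro!: imageI span_expo_mult)
qed

definition generator :: "real \<Rightarrow> nat \<Rightarrow> L0" where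
  "generator b = weighted (expo (\<lambda>n. b ^ n))"

lemma expo_power_in_span: "1 < b \<Longrightarrow> expo (\<lambda>n. b ^ n) \<in> span (expo ` exponents)"
  by (intro span_base imageI power_in_exponents)

lemma inj_on_generator: "inj_on generator {1<..}"
proof (rule inj_onI)
  fix b c :: real
  assume bc: "b \<in> {1<..}" "c \<in> {1<..}" and eq: "generator b = generator c"
  let ?u = "\<lambda>b. expo (\<lambda>n. b ^ n)"
  have "?u b - ?u c \<in> span (expo ` exponents)"
    using bc by (intro span_diff expo_power_in_span) auto
  moreover have "weighted (?u b - ?u c) = 0"
    using eq by (auto simp: generator_def weighted_def fun_eq_iff scaleR_diff_left)
  ultimately have "?u b = ?u c"
    using weighted_eq_0_iff by force
  then show "b = c"
    using injD[OF inj_expo] injD[OF inj_geometric] by blast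
qed

lemma free_generators_generator: "free_generators (generator ` {1<..})"
  unfolding free_generators_def
proof (intro allI impI, elim conjE)
  fix s P and f :: "nat \<Rightarrow> nat \<Rightarrow> L0"
  assume P: "in_variables s P" "P \<noteq> 0" "Poly_Mapping.lookup P 0 = 0"
    and f: "inj_on f {..<s}" "f ` {..<s} \<subseteq> generator ` {1<..}"
  define b where "b i = inv_into {1<..} generator (f i)" for i
  have b: "1 < b i" "f i = generator (b i)" if "i < s" for i
    using that f(2) inv_into_into[of "f i" generator "{1<..}"] f_inv_into_f[of "f i" generator "{1<..}"]
    by (auto simp: b_def)
  have inj: "inj_on b {..<s}"
    using f(1) b(2) by (metis inj_on_def lessThan_iff)
  have "f i = weighted (expo (\<lambda>n. b i ^ n))"
    if "a \<in> Poly_Mapping.keys P" "i \<in> Poly_Mapping.keys a" for a i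
    using P(1) that b(2)[of i] by (auto simp only: in_variables_def generator_def)
  then have "mpoly_eval f P = mpoly_eval (\<lambda>i. weighted (expo (\<lambda>n. b i ^ n))) P"
    unfolding mpoly_eval_def
    by (intro sum.cong prod.cong arg_cong2[where f = scaleR] arg_cong2[where f = power] refl)
  also have "\<dots> = weighted (mpoly_eval (\<lambda>i. expo (\<lambda>n. b i ^ n)) P)"
    using P(3) by (rule mpoly_eval_weighted)
  finally show "mpoly_eval f P \<noteq> 0"
    by (simp only: weighted_eq_0_iff[OF mpoly_eval_expo_in_span[OF P(1) b(1)]]
        mpoly_eval_expo_nonzero[OF P(1,2) inj b(1)] not_False_eq_True)
qed

theorem theorem2p2:
  shows "strongly_algebrable |UNIV :: real set|
    {F :: nat \<Rightarrow> L0. tendsto_in_measure F 0 \<and> \<not> tendsto_ae F 0}"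
  unfolding strongly_algebrable_def
proof (intro exI conjI)
  let ?B = "generator ` {1<..}"
  have "|{1::real<..}| =o |UNIV :: real set|"
    using eqpoll_real_subset[of 1 2 "{1<..}"] by (auto simp: eqpoll_iff_card_of_ordIso)
  moreover have "|{1::real<..}| =o |?B|"
    by (rule card_of_ordIsoI[of generator]) (simp add: inj_on_generator bij_betw_def)
  ultimately show "|?B| =o |UNIV :: real set|"
    using ordIso_transitive ordIso_symmetric by metis
  show "free_generators ?B"
    by (rule free_generators_generator)
  have "?B \<subseteq> weighted ` span (expo ` exponents)"
    by (auto simp: generator_def intro!: imageI expo_power_in_span)
  then have "subalgebra hull ?B \<subseteq> weighted ` span (expo ` exponents)"
    using subalgebra_weighted by (rule hull_minimal)
  then show "(subalgebra hull ?B) - {0} \<subseteq> {F. tendsto_in_measure F 0 \<and> \<not> tendsto_ae F 0}"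
    using weighted_span_expo weighted_0 by blast
qed

end
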